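(* Let $q$ be a complex number with $|q|<1$. Then $$\sum_{k=0}^{\infty}q^{\binom{k+1}{2}}[3k+2]\frac{(q;q)_{k}^2(q^{2};q^2)_{k}}{(q^3;q^2)_{k}^3}\left\{\sum_{i=1}^{k}\frac{q^{i}}{[i]^2}-\sum_{i=1}^{k+1}\frac{q^{2i-1}}{[2i-1]^2}\right\}=\frac{(q^2;q^2)_{\infty}^4}{(q;q^2)_{\infty}^2(q^3;q^2)_{\infty}^2}\sum_{j=1}^{\infty}(-1)^{j}\frac{q^{j}}{[j]^2}.$$
   Context: For complex $x$ and $p$ with $|p|<1$, the $q$-shifted factorials with base $p$ are $(x;p)_{\infty}=\prod_{i=0}^{\infty}(1-xp^i)$ and, for an integer $n\ge 0$, $(x;p)_n=(x;p)_\infty/(xp^n;p)_\infty$, i.e. $(x;p)_n=\prod_{i=0}^{n-1}(1-xp^i)$. A power such as $(x;p)_m^3$ means $((x;p)_m)^3$. The $q$-integer is $[n]=1+q+\cdots+q^{n-1}$. Empty sums are $0$. *)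

theory Defs
  imports "HOL-Analysis.Analysis"
begin

definition qpoch_inf :: "complex \<Rightarrow> complex \<Rightarrow> complex" where
  "qpoch_inf x p = (\<Prod>i. 1 - x * p ^ i)"

definition qpoch :: "complex \<Rightarrow> complex \<Rightarrow> nat \<Rightarrow> complex" where
  "qpoch x p n = (\<Prod>i<n. 1 - x * p ^ i)"

definition qint :: "complex \<Rightarrow> nat \<Rightarrow> complex" where
  "qint q n = (\<Sum>i<n. q ^ i)"

lemma convergent_prod_qpoch:
  assumes "norm (p::complex) < 1"
  shows "convergent_prod (\<lambda>i. 1 - x * p ^ i)"
proof (rule abs_convergent_prod_imp_convergent_prod)
  have "summable (\<lambda>i. norm x * norm p ^ i)"
    using assms by (intro summable_mult summable_geometric) simp
  then show "abs_convergent_prod (\<lambda>i. 1 - x * p ^ i)"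
    by (simp add: abs_convergent_prod_conv_summable norm_mult norm_power)
qed

text \<open>This is $(x;p)_n = (x;p)_\infty / (xp^n;p)_\infty$ without the division,
  hence also valid where the denominator vanishes.\<close>

lemma qpoch_mult_qpoch_inf:
  assumes "norm p < 1"
  shows "qpoch x p n * qpoch_inf (x * p ^ n) p = qpoch_inf x p"
proof (induction n)
  case 0
  show ?case by (simp add: qpoch_def)
next
  case (Suc n)
  let ?f = "\<lambda>i. 1 - (x * p ^ n) * p ^ i"
  have "(\<lambda>m. \<Prod>i\<le>Suc m. ?f i) \<longlonglongrightarrow> qpoch_inf (x * p ^ n) p"
    using LIMSEQ_Suc[OF convergent_prod_LIMSEQ[OF convergent_prod_qpoch[OF assms]]]
    unfolding qpoch_inf_def .
  moreover have "(\<Prod>i\<le>Suc m. ?f i) = ?f 0 * (\<Prod>i\<le>m. 1 - (x * p ^ Suc n) * p ^ i)" for m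
    unfolding prod.atMost_Suc_shift by (simp add: mult_ac)
  moreover have "(\<lambda>m. ?f 0 * (\<Prod>i\<le>m. 1 - (x * p ^ Suc n) * p ^ i))
                   \<longlonglongrightarrow> ?f 0 * qpoch_inf (x * p ^ Suc n) p"
    unfolding qpoch_inf_def
    by (intro tendsto_mult tendsto_const convergent_prod_LIMSEQ convergent_prod_qpoch assms)
  ultimately have eq: "qpoch_inf (x * p ^ n) p = ?f 0 * qpoch_inf (x * p ^ Suc n) p"
    by (simp only: LIMSEQ_unique)
  show ?case
    using Suc.IH unfolding eq by (simp add: qpoch_def mult.assoc)
qed

end

(* Put t = x + 1/x - 2. The series is, up to a factor, the coefficient of t in the case a = q^2,
   b = q x, c = q / x, d -> infinity of Gasper and Rahman's quadratic summation

     sum_k (1 - a q^(3k)) (a,d,aq/d;q^2)_k (b,c,aq/(bc);q)_k q^k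
             / ((q,aq/d,d;q)_k (aq^2/b,aq^2/c,bcq;q^2)_k).

   For d = q^(-2n) that sum terminates and has a product value, which follows from a WZ
   certificate. Differentiating the terminating identity at t = 0 turns each product into itself
   times a finite sum of terms q^m / (1 - q^m)^2, and letting n tend to infinity under the
   majorant C |q|^k (Tannery) gives both series. *)

theory Submission
  imports Defs
begin

text \<open>The equation \<open>wz_right_eq\<close> below with denominators cleared, where $A = q^{2(n-k)}$ and $K = q^k$.\<close>

lemma certificate_identity:
  fixes q A K t :: complex
  defines "D \<equiv> \<lambda>x. (1 - x)^2 - x * t"
  shows "(1 - A*K*q) * (1 - A*K*q^2) * (1 - A*K^4*q^3) * ((1 - A*K^2*q^3) * D (A*K^2*q^3) * (1 - K^3*q^2))
     - A*q^2 * (1 - K) * D (K^2*q) * (1 - K^2*q) * (1 - A*K*q) * (1 - A^2*K^4*q^5) * (1 - A*K^3*q^4)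
     - (1 - A*K^2*q^2) * D (A*K^2*q^2) * ((1 - A*q^2) * (1 - A*K^3*q^3) * (1 - A*K^3*q^4) * (1 - K^3*q^2))
     + A*K*q * (1 - K*q) * (1 - A^2*K^4*q^5) * (1 - K^2*q^2) * D (K*q) * (1 - A*K^4*q^3) * (1 - A*q^2) = 0"
  unfolding D_def by algebra

section \<open>Terms, product value and WZ certificate of the terminating sum\<close>

context
  fixes q :: complex
  assumes q: "norm q < 1"
begin

definition qz :: "nat \<Rightarrow> complex" where
  "qz m = 1 - q ^ m"

text \<open>With $t = x + 1/x - 2$ this is $(1 - q^m x)(1 - q^m / x)$.\<close>

definition qzt :: "nat \<Rightarrow> complex \<Rightarrow> complex" where
  "qzt m t = (qz m)^2 - q ^ m * t"

text \<open>For \<open>k \<le> n\<close> this is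
  $\frac{(q^{-2n};q^2)_k (q^{2n+3};q^2)_k}{(q^{-2n};q)_k (q^{2n+3};q)_k}$, written without negative powers
  of \<open>q\<close>; it makes the sum terminate at \<open>k = n\<close>.\<close>

definition twist :: "nat \<Rightarrow> nat \<Rightarrow> complex" where
  "twist n k = (\<Prod>i<k. q ^ i * (qz (2 * (n - i)) / qz (2 * n - i))
                        * (qz (2 * n + 3 + 2 * i) / qz (2 * n + 3 + i)))"

text \<open>The part of the term that is free of t. For a = q^2, b = q x, c = q / x the factors
  (aq/(bc);q)_k and (q;q)_k of the quadratic summation coincide and cancel; (a;q^2)_k and
  (bcq;q^2)_k give the two products.\<close>

definition coef :: "nat \<Rightarrow> nat \<Rightarrow> complex" where
  "coef n k = qz (3 * k + 2) * q ^ k * ((\<Prod>i<k. qz (2 * i + 2)) / (\<Prod>i<k. qz (2 * i + 3))) * twist n k"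

text \<open>The denominator starts at \<open>qzt 1 t\<close>, a factor independent of k that the
  quadratic summation lacks. Its derivative supplies the term i = 1 of the sum over odd
  indices.\<close>

definition summand :: "nat \<Rightarrow> nat \<Rightarrow> complex \<Rightarrow> complex" where
  "summand n k t = coef n k * ((\<Prod>i<k. qzt (i + 1) t) / (\<Prod>i<Suc k. qzt (2 * i + 1) t))"

definition total_coef :: "nat \<Rightarrow> complex" where
  "total_coef n = (\<Prod>i<Suc n. qz (2 * i + 2)) * (\<Prod>i<n. qz (2 * i + 2))
     / ((\<Prod>i<n. qz (2 * i + 1)) * (\<Prod>i<n. qz (2 * i + 3)))"

definition total :: "nat \<Rightarrow> complex \<Rightarrow> complex" where
  "total n t = total_coef n * ((\<Prod>i<n. qzt (2 * i + 2) t) / (\<Prod>i<Suc n. qzt (2 * i + 1) t))"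

definition total_quot :: "nat \<Rightarrow> complex \<Rightarrow> complex" where
  "total_quot n t = qz (2 * n + 4) * qz (2 * n + 2) * qzt (2 * n + 2) t / (qz (2 * n + 1) * qz (2 * n + 3) * qzt (2 * n + 3) t)"

definition wz_right :: "nat \<Rightarrow> nat \<Rightarrow> complex \<Rightarrow> complex" where
  "wz_right n k t = - (q ^ (2 * n + 1 - k) * qz (k + 1) * qz (4 * n + 5) * qz (2 * n + 4) * qz (2 * k + 2)
        * qzt (k + 1) t * qz (2 * n + 3 + 2 * k))
     / (qz (2 * n + 4 + k) * qz (2 * n + 3 + k) * qz (2 * n + 1) * qz (2 * n + 3) * qzt (2 * n + 3) t * qz (3 * k + 2))"

definition wz_left :: "nat \<Rightarrow> nat \<Rightarrow> complex \<Rightarrow> complex" where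
  "wz_left n k t = - (q ^ (2 * (n - k) + 2) * qz k * qzt (2 * k + 1) t * qz (2 * k + 1) * qz (2 * n + 1 - k)
        * qz (4 * n + 5) * qz (2 * n + 4))
     / (qz (3 * k + 2) * qz (2 * (n - k) + 2) * qz (2 * n + 3 + k) * qz (2 * n + 1) * qz (2 * n + 3) * qzt (2 * n + 3) t)"

text \<open>The ratio of \<open>twist (Suc n) k\<close> to \<open>twist n k\<close> for k \<le> n,
  after telescoping. As only \<open>twist\<close> involves n, it is also the ratio of the
  summands.\<close>

definition twist_quot :: "nat \<Rightarrow> nat \<Rightarrow> complex" where
  "twist_quot n k = qz (2 * n + 1 - k) * qz (2 * n + 2 - k) / (qz (2 * n + 1) * qz (2 * (n - k) + 2))
     * (qz (2 * n + 3 + 2 * k) * qz (2 * n + 4) / (qz (2 * n + 3 + k) * qz (2 * n + 4 + k)))"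

lemma qz_nonzero: "m > 0 \<Longrightarrow> qz m \<noteq> 0"
proof
  assume "m > 0" "qz m = 0"
  then have "norm (q ^ m) = 1" by (simp add: qz_def)
  moreover have "norm (q ^ m) < 1"
    using q \<open>m > 0\<close> by (simp add: norm_power power_less_one_iff)
  ultimately show False by simp
qed

text \<open>Writing $T(n,k)$ for \<open>summand n k t\<close> and $\rho_n$ for \<open>total_quot n t\<close>, this is the WZ relation
  $T(n+1,k) - \rho_n T(n,k) = H(n,k+1) - H(n,k)$ divided by $T(n,k)$: \<open>wz_left\<close> is $H(n,k) / T(n,k)$ and \<open>wz_right\<close> is $H(n,k+1) / T(n,k)$. The latter, unlike the former
  at $k+1$, remains meaningful for \<open>k = n\<close>.\<close>

lemma wz_right_eq:
  assumes "k \<le> n" "qzt (2 * n + 3) t \<noteq> 0"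
  shows "wz_right n k t = wz_left n k t + twist_quot n k - total_quot n t"
proof -
  \<comment> \<open>With n = k + d every truncated subtraction becomes a sum, and each power of q
    becomes a monomial in A, K and q.\<close>
  obtain d where n: "n = k + d" using assms(1) le_Suc_ex by blast
  define A K where "A = q ^ (2 * d)" and "K = q ^ k"
  have e: "2 * n + 1 - k = 2 * d + k + 1" "2 * n + 2 - k = 2 * d + k + 2" "n - k = d"
    by (auto simp: n)
  have zs: "qz (2*d+k+1) = 1 - A*K*q" "qz (2*d+k+2) = 1 - A*K*q^2" "qz (2*n+3+2*k) = 1 - A*K^4*q^3"
    "qz (2*n+3) = 1 - A*K^2*q^3" "qz (3*k+2) = 1 - K^3*q^2" "qz k = 1 - K" "qz (2*k+1) = 1 - K^2*q"
    "qz (4*n+5) = 1 - A^2*K^4*q^5" "qz (2*n+4+k) = 1 - A*K^3*q^4" "qz (2*n+2) = 1 - A*K^2*q^2"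
    "qz (2*d+2) = 1 - A*q^2" "qz (2*n+3+k) = 1 - A*K^3*q^3" "qz (k+1) = 1 - K*q"
    "qz (2*k+2) = 1 - K^2*q^2"
    by (simp_all add: qz_def n A_def K_def eval_nat_numeral power_add power_mult_distrib)
  have qs: "q ^ (2*d+k+1) = A*K*q" "q ^ (2*d+2) = A*q^2" "q ^ (2*k+1) = K^2*q" "q ^ (2*n+3) = A*K^2*q^3"
    "q ^ (2*n+2) = A*K^2*q^2" "q ^ (k+1) = K*q"
    by (simp_all add: n A_def K_def eval_nat_numeral power_add power_mult_distrib)
  have key: "qz (2*d+k+1) * qz (2*d+k+2) * qz (2*n+3+2*k) * (qz (2*n+3) * qzt (2*n+3) t * qz (3*k+2))
     - q ^ (2*d+2) * qz k * qzt (2*k+1) t * qz (2*k+1) * qz (2*d+k+1) * qz (4*n+5) * qz (2*n+4+k)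
     - qz (2*n+2) * qzt (2*n+2) t * (qz (2*d+2) * qz (2*n+3+k) * qz (2*n+4+k) * qz (3*k+2))
     + q ^ (2*d+k+1) * qz (k+1) * qz (4*n+5) * qz (2*k+2) * qzt (k+1) t * qz (2*n+3+2*k) * qz (2*d+2) = 0"
    (is "?X = 0")
    unfolding qzt_def zs qs by (rule certificate_identity)
  have nz: "qz (2*n+1) \<noteq> 0" "qz (2*n+3) \<noteq> 0" "qz (2*d+2) \<noteq> 0" "qz (2*n+3+k) \<noteq> 0" "qz (2*n+4+k) \<noteq> 0"
    "qz (3*k+2) \<noteq> 0"
    by (auto intro!: qz_nonzero)
  \<comment> \<open>Denominators are cleared over opaque variables; what remains in the numerator is
    the polynomial \<open>?X\<close> that vanishes by \<open>key\<close>.\<close>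
  have alg: "- (p * a * b * c * e * f * g) / (h * i * j * l * m * o')
    - (- (p' * a' * m' * e' * f' * b * c) / (o' * h' * i * j * l * m)
       + f' * g' / (j * h') * (g * c / (i * h)) - c * r * s / (j * l * m))
    = - c * (f' * g' * g * (l * m * o') - p' * a' * m' * e' * f' * b * h - r * s * (h' * i * h * o')
         + p * a * b * e * f * g * h') / (j * l * m * h' * i * h * o')"
    if "h \<noteq> 0" "i \<noteq> 0" "j \<noteq> 0" "l \<noteq> 0" "m \<noteq> 0" "o' \<noteq> 0" "h' \<noteq> 0"
    for p a b c e f g h i j l m o' p' a' m' e' f' h' g' r s :: complex
    using that by (simp add: field_simps)
  have "wz_right n k t - (wz_left n k t + twist_quot n k - total_quot n t)
      = - qz (2*n+4) * ?X / (qz (2*n+1) * qz (2*n+3) * qzt (2*n+3) t * qz (2*d+2) * qz (2*n+3+k) * qz (2*n+4+k) * qz (3*k+2))"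
    unfolding wz_right_def wz_left_def twist_quot_def total_quot_def e
    by (rule alg) (use nz assms(2) in auto)
  then show ?thesis unfolding key by simp
qed

section \<open>Ratios of neighbouring terms in k and in n\<close>

lemma twist_Suc: "twist n (Suc k) = twist n k * (q ^ k * (qz (2 * (n - k)) / qz (2 * n - k))
      * (qz (2 * n + 3 + 2 * k) / qz (2 * n + 3 + k)))"
  by (simp add: twist_def)

lemma twist_Suc_left: "k \<le> n \<Longrightarrow> twist (Suc n) k = twist n k * twist_quot n k"
proof (induction k)
  case 0
  have "qz (2*n+1) \<noteq> 0" "qz (2*n+2) \<noteq> 0" "qz (2*n+3) \<noteq> 0" "qz (2*n+4) \<noteq> 0"
    by (auto intro!: qz_nonzero)
  then show ?case by (simp add: twist_def twist_quot_def)
next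
  case (Suc k)
  then obtain d where n: "n = Suc k + d" using le_Suc_ex by blast
  have IH: "twist (Suc n) k = twist n k * twist_quot n k" using Suc by simp
  have e: "2 * n + 1 - k = 2*d+k+3" "2 * n + 2 - k = 2*d+k+4" "n - k = Suc d" "2*n - k = 2*d+k+2"
    "2 * Suc n - k = 2*d+k+4" "2 * n + 1 - Suc k = 2*d+k+2" "2 * n + 2 - Suc k = 2*d+k+3" "n - Suc k = d"
    "Suc n - k = d + 2" "2 * Suc n + 3 + 2 * k = 2*n+5+2*k" "2 * Suc n + 3 + k = 2*n+5+k"
    "2 * n + 3 + 2 * Suc k = 2*n+5+2*k" "2 * n + 3 + Suc k = 2*n+4+k" "2 * n + 4 + Suc k = 2*n+5+k"
    "2 * Suc d = 2 * d + 2" "2 * (d + 2) = 2 * d + 4" "2 * d + 2 + 2 = 2 * d + 4"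
    by (auto simp: n)
  have nz: "qz (2*d+2) \<noteq> 0" "qz (2*d+4) \<noteq> 0" "qz (2*d+k+2) \<noteq> 0" "qz (2*d+k+3) \<noteq> 0" "qz (2*d+k+4) \<noteq> 0"
    "qz (2*n+1) \<noteq> 0" "qz (2*n+3+k) \<noteq> 0" "qz (2*n+4+k) \<noteq> 0" "qz (2*n+5+k) \<noteq> 0" "qz (2*n+3+2*k) \<noteq> 0"
    by (auto intro!: qz_nonzero)
  show ?case
    unfolding twist_Suc IH twist_quot_def e using nz by (simp add: mult_ac)
qed


lemma summand_Suc_left: "k \<le> n \<Longrightarrow> summand (Suc n) k t = summand n k t * twist_quot n k"
  by (simp add: summand_def coef_def twist_Suc_left)

lemma summand_Suc: "summand n (Suc k) t = summand n k t * (qz (3 * k + 5) / qz (3 * k + 2) * q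
     * (qz (2 * k + 2) / qz (2 * k + 3)) * (qzt (k + 1) t / qzt (2 * k + 3) t)
     * (q ^ k * (qz (2 * (n - k)) / qz (2 * n - k)) * (qz (2 * n + 3 + 2 * k) / qz (2 * n + 3 + k))))"
proof -
  have e: "3 * Suc k + 2 = 3 * k + 5" "2 * Suc k + 1 = 2 * k + 3" by auto
  have "qz (3 * k + 2) \<noteq> 0" by (rule qz_nonzero) simp
  then show ?thesis
    unfolding summand_def coef_def twist_Suc e prod.lessThan_Suc[of _ "Suc k"]
    by (simp add: e mult_ac)
qed

text \<open>Both sides are H(n,k+1), so consecutive WZ relations can be chained. At k = n the right
  side would be 0, because \<open>twist n (Suc n)\<close> contains \<open>qz 0\<close>; that end is
  left to \<open>wz_right_last\<close>.\<close>

lemma wz_right_step: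
  assumes "k < n" "qzt (2 * k + 3) t \<noteq> 0"
  shows "wz_right n k t * summand n k t = wz_left n (Suc k) t * summand n (Suc k) t"
proof -
  obtain d where n: "n = Suc k + d" using assms(1) less_iff_Suc_add[of k n] by auto
  have e: "2 * n + 1 - k = 2*d+k+3" "n - k = Suc d" "n - Suc k = d" "2*n - k = 2*d+k+2"
    "2 * n + 1 - Suc k = 2*d+k+2" "2 * Suc k + 1 = 2*k+3" "2 * n + 3 + Suc k = 2*n+4+k"
    "3 * Suc k + 2 = 3*k+5" "2 * Suc d = 2*d+2"
    by (auto simp: n)
  have nz: "qz (2*d+k+2) \<noteq> 0" "qz (2*d+2) \<noteq> 0" "qz (2*k+3) \<noteq> 0" "qz (3*k+5) \<noteq> 0"
    by (auto intro!: qz_nonzero)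
  have "q ^ (2*d+k+3) = q ^ (2*d+2) * q * q ^ k"
    by (simp add: power_add eval_nat_numeral)
  then show ?thesis
    unfolding summand_Suc wz_right_def wz_left_def e using nz assms(2) by (simp add: mult_ac)
qed

text \<open>The boundary condition at the upper end: the sum for n + 1 has one more term than the
  sum for n, and this term cancels the H(n,n+1) left by telescoping.\<close>

lemma wz_right_last:
  assumes "qzt (2 * n + 3) t \<noteq> 0"
  shows "summand (Suc n) (Suc n) t = - wz_right n n t * summand n n t"
proof -
  have e: "2 * Suc n + 3 + 2 * n = 4*n+5" "2 * Suc n + 3 + n = 3*n+5" "2 * (Suc n - n) = 2"
    "2 * Suc n - n = n+2" "2*n+1-n = n+1" "2*n+2-n = n+2" "2 * (n - n) + 2 = 2" "2*n+3+2*n=4*n+3"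
    "2*n+3+n = 3*n+3" "2*n+4+n = 3*n+4"
    by auto
  have nz: "qz 2 \<noteq> 0" "qz (n+2) \<noteq> 0" "qz (n+1) \<noteq> 0" "qz (3*n+5) \<noteq> 0"
    by (auto intro!: qz_nonzero)
  show ?thesis
    unfolding summand_Suc summand_Suc_left[OF order_refl] twist_quot_def wz_right_def e
    using nz by (simp add: mult_ac)
qed

section \<open>Telescoping to the terminating identity\<close>

lemma partial_sum:
  assumes "k \<le> n" "\<And>i. i \<le> Suc n \<Longrightarrow> qzt (2 * i + 1) t \<noteq> 0"
  shows "(\<Sum>j\<le>k. summand (Suc n) j t) - total_quot n t * (\<Sum>j\<le>k. summand n j t) = wz_right n k t * summand n k t"
  using assms(1)
proof (induction k)
  case 0
  have nz: "qzt (2 * n + 3) t \<noteq> 0" using assms(2)[of "Suc n"] by (simp add: eval_nat_numeral)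
  \<comment> \<open>H(n,0) = 0, since \<open>wz_left n 0 t\<close> has the factor
    \<open>qz 0\<close>.\<close>
  have "wz_right n 0 t = twist_quot n 0 - total_quot n t"
    using wz_right_eq[of 0 n t] nz by (simp add: wz_left_def qz_def)
  then show ?case by (simp add: summand_Suc_left left_diff_distrib)
next
  case (Suc k)
  have nz: "qzt (2 * n + 3) t \<noteq> 0" using assms(2)[of "Suc n"] by (simp add: eval_nat_numeral)
  have nz': "qzt (2 * k + 3) t \<noteq> 0" using assms(2)[of "Suc k"] Suc.prems by (simp add: eval_nat_numeral)
  have "(\<Sum>j\<le>Suc k. summand (Suc n) j t) - total_quot n t * (\<Sum>j\<le>Suc k. summand n j t)
      = wz_right n k t * summand n k t + (twist_quot n (Suc k) - total_quot n t) * summand n (Suc k) t"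
    using Suc by (simp add: summand_Suc_left algebra_simps)
  also have "\<dots> = (wz_left n (Suc k) t + twist_quot n (Suc k) - total_quot n t) * summand n (Suc k) t"
    using Suc.prems wz_right_step[of k n t, OF _ nz'] by (simp add: algebra_simps)
  also have "\<dots> = wz_right n (Suc k) t * summand n (Suc k) t"
    by (simp add: wz_right_eq[OF Suc.prems nz])
  finally show ?case .
qed

lemma total_Suc: "total (Suc n) t = total_quot n t * total n t"
proof -
  have "2 * Suc n + 2 = 2 * n + 4" "2 * Suc n + 1 = 2 * n + 3" by auto
  then show ?thesis
    by (simp add: total_def total_coef_def total_quot_def mult_ac eval_nat_numeral)
qed

lemma sum_summand:
  assumes "\<And>i. i \<le> n \<Longrightarrow> qzt (2 * i + 1) t \<noteq> 0"
  shows "(\<Sum>k\<le>n. summand n k t) = total n t"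
  using assms
proof (induction n)
  case 0
  show ?case by (simp add: summand_def coef_def twist_def total_def total_coef_def)
next
  case (Suc n)
  have nz: "qzt (2 * n + 3) t \<noteq> 0" using Suc.prems[of "Suc n"] by (simp add: eval_nat_numeral)
  have "(\<Sum>k\<le>Suc n. summand (Suc n) k t) = total_quot n t * (\<Sum>k\<le>n. summand n k t)"
    using partial_sum[OF order_refl Suc.prems] wz_right_last[OF nz] by (simp add: algebra_simps)
  then show ?case using Suc by (simp add: total_Suc)
qed


section \<open>Differentiation at t = 0\<close>

lemma qzt_0 [simp]: "qzt m 0 = (qz m)^2"
  by (simp add: qzt_def)

text \<open>Minus the logarithmic derivative of \<open>qzt m\<close> at t = 0.\<close>

definition lambert :: "nat \<Rightarrow> complex" where
  "lambert m = q ^ m / (qz m)^2"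

lemma has_field_derivative_prod_qzt:
  assumes "\<And>i. i \<in> I \<Longrightarrow> 0 < g i"
  shows "((\<lambda>t. \<Prod>i\<in>I. qzt (g i) t) has_field_derivative
           (\<Prod>i\<in>I. (qz (g i))^2) * - (\<Sum>i\<in>I. lambert (g i))) (at 0)"
proof -
  have "((\<lambda>t. \<Prod>i\<in>I. qzt (g i) t) has_field_derivative
           (\<Prod>i\<in>I. qzt (g i) 0) * (\<Sum>i\<in>I. - (q ^ g i) / qzt (g i) 0)) (at 0)"
  proof (rule has_field_derivative_prod')
    fix i assume "i \<in> I"
    then show "qzt (g i) 0 \<noteq> 0" using qz_nonzero assms by simp
    show "(qzt (g i) has_field_derivative - (q ^ g i)) (at 0)"
      unfolding qzt_def by (auto intro!: derivative_eq_intros)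
  qed
  then show ?thesis by (simp add: lambert_def sum_negf)
qed

lemma has_field_derivative_qzt_quot:
  assumes "\<And>i. i \<in> I \<Longrightarrow> 0 < g i" "\<And>j. j \<in> J \<Longrightarrow> 0 < h j"
  shows "((\<lambda>t. c * ((\<Prod>i\<in>I. qzt (g i) t) / (\<Prod>j\<in>J. qzt (h j) t))) has_field_derivative
           c * ((\<Prod>i\<in>I. qz (g i)) / (\<Prod>j\<in>J. qz (h j)))^2
             * ((\<Sum>j\<in>J. lambert (h j)) - (\<Sum>i\<in>I. lambert (g i)))) (at 0)"
proof -
  \<comment> \<open>A product over an infinite J is 1 by default, hence the case split.\<close>
  have nz: "(\<Prod>j\<in>J. qz (h j)) \<noteq> 0"
    using assms qz_nonzero by (cases "finite J") auto
  have alg: "c * ((G\<^sup>2 * - a * H\<^sup>2 - G\<^sup>2 * (H\<^sup>2 * - b)) / (H\<^sup>2 * H\<^sup>2)) = c * (G / H)\<^sup>2 * (b - a)"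
    if "H \<noteq> 0" for a b G H :: complex
    using that by (simp add: field_simps)
  have "((\<lambda>t. (\<Prod>i\<in>I. qzt (g i) t) / (\<Prod>j\<in>J. qzt (h j) t)) has_field_derivative
      ((\<Prod>i\<in>I. (qz (g i))^2) * - (\<Sum>i\<in>I. lambert (g i)) * (\<Prod>j\<in>J. qzt (h j) 0)
        - (\<Prod>i\<in>I. qzt (g i) 0) * ((\<Prod>j\<in>J. (qz (h j))^2) * - (\<Sum>j\<in>J. lambert (h j))))
      / ((\<Prod>j\<in>J. qzt (h j) 0) * (\<Prod>j\<in>J. qzt (h j) 0))) (at 0)"
    by (intro DERIV_divide has_field_derivative_prod_qzt assms) (use nz in \<open>auto simp: prod_power_distrib[symmetric]\<close>)
  from DERIV_cmult[OF this, of c] show ?thesis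
    by (rule DERIV_cong) (use alg[OF nz] in \<open>simp add: prod_power_distrib[symmetric]\<close>)
qed

text \<open>The derivative of \<open>summand n k\<close> at t = 0. Denominators contribute
  positively, so the difference of sums is the negative of the braces in the theorem.\<close>

definition dsummand :: "nat \<Rightarrow> nat \<Rightarrow> complex" where
  "dsummand n k = coef n k * ((\<Prod>i<k. qz (i + 1)) / (\<Prod>i<Suc k. qz (2 * i + 1)))^2
     * ((\<Sum>i<Suc k. lambert (2 * i + 1)) - (\<Sum>i<k. lambert (i + 1)))"

definition dtotal :: "nat \<Rightarrow> complex" where
  "dtotal n = total_coef n * ((\<Prod>i<n. qz (2 * i + 2)) / (\<Prod>i<Suc n. qz (2 * i + 1)))^2
     * ((\<Sum>i<Suc n. lambert (2 * i + 1)) - (\<Sum>i<n. lambert (2 * i + 2)))"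

text \<open>Uniqueness of derivatives: the two functions of t agree wherever the finitely many
  factors \<open>qzt (2 * i + 1) t\<close> are nonzero, which by continuity includes a neighbourhood
  of 0.\<close>

lemma sum_dsummand: "(\<Sum>k\<le>n. dsummand n k) = dtotal n"
proof (rule DERIV_unique)
  show "(total n has_field_derivative dtotal n) (at 0)"
    unfolding total_def dtotal_def by (rule has_field_derivative_qzt_quot) auto
  have "((\<lambda>t. \<Sum>k\<le>n. summand n k t) has_field_derivative (\<Sum>k\<le>n. dsummand n k)) (at 0)"
    unfolding summand_def dsummand_def by (intro DERIV_sum has_field_derivative_qzt_quot) auto
  moreover have "\<forall>\<^sub>F t in nhds 0. \<forall>i\<in>{..n}. qzt (2 * i + 1) t \<noteq> 0"
  proof (rule eventually_ball_finite, simp, rule ballI)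
    fix i
    have "isCont (qzt (2 * i + 1)) 0"
      unfolding qzt_def by (intro continuous_intros)
    moreover have "qzt (2 * i + 1) 0 \<noteq> 0" using qz_nonzero by simp
    ultimately show "\<forall>\<^sub>F t in nhds 0. qzt (2 * i + 1) t \<noteq> 0"
      by (intro tendsto_imp_eventually_ne[of "qzt (2 * i + 1)" "qzt (2 * i + 1) 0"])
         (simp_all add: isCont_def tendsto_nhds_iff)
  qed
  then have "\<forall>\<^sub>F t in nhds 0. (\<Sum>k\<le>n. summand n k t) = total n t"
    by eventually_elim (simp add: sum_summand)
  ultimately show "(total n has_field_derivative (\<Sum>k\<le>n. dsummand n k)) (at 0)"
    by (subst (asm) DERIV_cong_ev) auto
qed

section \<open>Bounds uniform in n\<close>

definition prod_bound :: real where
  "prod_bound = exp (1 / (1 - norm q)^2)"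

lemma norm_power_le: "m > 0 \<Longrightarrow> norm q ^ m \<le> norm q"
  using power_decreasing[of 1 m "norm q"] q by simp

text \<open>Injectivity of g makes the exponents distinct, so their powers of |q| sum to at most 1 /
  (1 - |q|); dividing once more by 1 - |q| gives the exponent in \<open>prod_bound\<close>. The same
  constant then serves products of \<open>qz\<close> and their reciprocals.\<close>

lemma prod_exp_bound:
  assumes "finite I" "inj_on g I" "\<And>i. i \<in> I \<Longrightarrow> norm (f i) \<le> exp (norm q ^ g i / (1 - norm q))"
  shows "norm (\<Prod>i\<in>I. f i :: complex) \<le> prod_bound"
proof -
  have "norm (\<Prod>i\<in>I. f i) \<le> (\<Prod>i\<in>I. exp (norm q ^ g i / (1 - norm q)))"
    unfolding prod_norm[symmetric] using assms(3) by (intro prod_mono) auto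
  also have "\<dots> = exp ((\<Sum>m\<in>g ` I. norm q ^ m) / (1 - norm q))"
    using assms(1,2) by (simp add: exp_sum sum_divide_distrib sum.reindex)
  also have "(\<Sum>m\<in>g ` I. norm q ^ m) \<le> (\<Sum>m. norm q ^ m)"
    using assms(1) q by (intro sum_le_suminf summable_geometric) auto
  also have "(\<Sum>m. norm q ^ m) = 1 / (1 - norm q)"
    using q by (simp add: suminf_geometric)
  finally show ?thesis using q by (simp add: prod_bound_def power2_eq_square divide_right_mono)
qed

lemma norm_prod_qz_le:
  assumes "finite I" "inj_on g I"
  shows "norm (\<Prod>i\<in>I. qz (g i)) \<le> prod_bound"
proof (rule prod_exp_bound[OF assms])
  fix i
  have "norm (qz (g i)) \<le> 1 + norm q ^ g i"
    unfolding qz_def by (metis norm_one norm_power norm_triangle_ineq4)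
  also have "norm q ^ g i \<le> norm q ^ g i / (1 - norm q)"
    using q by (simp add: field_simps)
  also have "1 + norm q ^ g i / (1 - norm q) \<le> exp (norm q ^ g i / (1 - norm q))"
    by (rule exp_ge_add_one_self)
  finally show "norm (qz (g i)) \<le> exp (norm q ^ g i / (1 - norm q))" by simp
qed

lemma norm_qz_ge: "norm (qz m) \<ge> 1 - norm q ^ m"
  unfolding qz_def by (metis norm_one norm_power norm_triangle_ineq2)

lemma norm_prod_qz_ge:
  assumes "finite I" "inj_on g I" "\<And>i. i \<in> I \<Longrightarrow> 0 < g i"
  shows "norm (inverse (\<Prod>i\<in>I. qz (g i))) \<le> prod_bound"
  unfolding prod_inversef[symmetric] o_def
proof (rule prod_exp_bound[OF assms(1,2)])
  fix i assume "i \<in> I"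
  then have "0 < g i" using assms(3) by simp
  let ?x = "norm q ^ g i"
  have x: "0 \<le> ?x" "?x \<le> norm q" "?x < 1" using norm_power_le[OF \<open>0 < g i\<close>] q by auto
  have "norm (inverse (qz (g i))) \<le> inverse (1 - ?x)"
    using norm_qz_ge[of "g i"] x by (simp add: norm_inverse le_imp_inverse_le)
  also have "\<dots> = 1 + ?x / (1 - ?x)" using x by (simp add: field_simps)
  also have "\<dots> \<le> 1 + ?x / (1 - norm q)" using x q by (intro add_left_mono divide_left_mono) auto
  also have "\<dots> \<le> exp (?x / (1 - norm q))" by (rule exp_ge_add_one_self)
  finally show "norm (inverse (qz (g i))) \<le> exp (?x / (1 - norm q))" .
qed

lemma norm_lambert_le: "m > 0 \<Longrightarrow> norm (lambert m) \<le> norm q ^ m / (1 - norm q)^2"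
proof -
  assume m: "m > 0"
  have "1 - norm q \<le> norm (qz m)" using norm_qz_ge[of m] norm_power_le[OF m] by simp
  then have "(1 - norm q)^2 \<le> norm (qz m)^2" using q by (intro power_mono) auto
  then show ?thesis
    using q by (auto simp: lambert_def norm_divide norm_power intro!: frac_le)
qed

lemma summable_lambert: "summable (\<lambda>j. (-1) ^ j * lambert (j + 1))"
proof (rule summable_comparison_test')
  show "summable (\<lambda>j. norm q ^ (j + 1) / (1 - norm q)^2)"
    using q by (intro summable_divide summable_ignore_initial_segment summable_geometric) auto
  show "norm ((-1) ^ j * lambert (j + 1)) \<le> norm q ^ (j + 1) / (1 - norm q)^2" if "j \<ge> 0" for j
    using norm_lambert_le[of "j + 1"] by (simp add: norm_mult norm_power)
qed

lemma norm_sum_lambert_le: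
  assumes "finite I" "inj_on g I" "\<And>i. i \<in> I \<Longrightarrow> 0 < g i"
  shows "norm (\<Sum>i\<in>I. lambert (g i)) \<le> 1 / (1 - norm q)^3"
proof -
  have "norm (\<Sum>i\<in>I. lambert (g i)) \<le> (\<Sum>i\<in>I. norm q ^ g i / (1 - norm q)^2)"
    using assms(3) by (intro sum_norm_le norm_lambert_le) auto
  also have "\<dots> = (\<Sum>m\<in>g ` I. norm q ^ m) / (1 - norm q)^2"
    using assms(1,2) by (simp add: sum_divide_distrib sum.reindex)
  also have "\<dots> \<le> (\<Sum>m. norm q ^ m) / (1 - norm q)^2"
    using assms(1) q by (intro divide_right_mono sum_le_suminf summable_geometric) auto
  also have "\<dots> = 1 / (1 - norm q)^3"
    using q by (simp add: suminf_geometric power2_eq_square power3_eq_cube)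
  finally show ?thesis .
qed


lemma prod_qz_qpoch:
  "(\<Prod>i<n. qz (2 * i + 2)) = qpoch (q^2) (q^2) n"
  "(\<Prod>i<n. qz (2 * i + 1)) = qpoch q (q^2) n"
  "(\<Prod>i<n. qz (2 * i + 3)) = qpoch (q^3) (q^2) n"
  "(\<Prod>i<n. qz (i + 1)) = qpoch q q n"
  by (simp_all add: qpoch_def qz_def power_add power_mult_distrib eval_nat_numeral mult_ac)

lemma prod_bound_ge_1: "prod_bound \<ge> 1"
  using q by (simp add: prod_bound_def)

lemma norm_twist_le:
  assumes "k \<le> n"
  shows "norm (twist n k) \<le> prod_bound ^ 4"
proof -
  have eq: "twist n k = (\<Prod>i<k. q ^ i) * (\<Prod>i<k. qz (2 * (n - i))) * inverse (\<Prod>i<k. qz (2 * n - i))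
      * ((\<Prod>i<k. qz (2 * n + 3 + 2 * i)) * inverse (\<Prod>i<k. qz (2 * n + 3 + i)))"
    unfolding twist_def prod.distrib prod_dividef unfolding divide_inverse mult.assoc by (rule refl)
  have "norm (\<Prod>i<k. q ^ i) \<le> 1"
    using q by (auto simp: prod_norm[symmetric] norm_power intro!: prod_le_1 power_le_one)
  moreover have "norm (\<Prod>i<k. qz (2 * (n - i))) \<le> prod_bound" "norm (\<Prod>i<k. qz (2 * n + 3 + 2 * i)) \<le> prod_bound"
    using assms by (intro norm_prod_qz_le; auto simp: inj_on_def)+
  moreover have "norm (inverse (\<Prod>i<k. qz (2 * n - i))) \<le> prod_bound"
    "norm (inverse (\<Prod>i<k. qz (2 * n + 3 + i))) \<le> prod_bound"
    \<comment> \<open>Here k \<le> n keeps the exponents 2n - i positive and distinct.\<close>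
    using assms by (intro norm_prod_qz_ge; auto simp: inj_on_def)+
  ultimately have "norm (twist n k) \<le> 1 * prod_bound * prod_bound * (prod_bound * prod_bound)"
    unfolding eq norm_mult using prod_bound_ge_1 by (intro mult_mono) auto
  then show ?thesis by (simp add: power4_eq_xxxx mult_ac)
qed

text \<open>The decay comes from the factor q^k in \<open>coef\<close>. Of the ten powers of
  \<open>prod_bound\<close>, two come from the quotient in \<open>coef\<close>, four from
  \<open>twist\<close> and four from the squared quotient; 4 is 2 for \<open>qz (3 * k + 2)\<close>
  times 2 for the two Lambert sums.\<close>

lemma norm_dsummand_le:
  assumes "k \<le> n"
  shows "norm (dsummand n k) \<le> 4 * prod_bound ^ 10 / (1 - norm q)^3 * norm q ^ k"
proof -
  have "norm (qz (3 * k + 2)) \<le> norm (1::complex) + norm (q ^ (3 * k + 2))"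
    unfolding qz_def by (rule norm_triangle_ineq4)
  also have "\<dots> \<le> 2"
    using power_le_one[OF norm_ge_zero less_imp_le[OF q], of "3 * k + 2"]
    unfolding norm_power norm_one by linarith
  finally have 1: "norm (qz (3 * k + 2)) \<le> 2" .
  have 2: "norm (\<Prod>i<k. qz (2 * i + 2)) \<le> prod_bound" "norm (\<Prod>i<k. qz (i + 1)) \<le> prod_bound"
    by (intro norm_prod_qz_le; auto simp: inj_on_def)+
  have 3: "norm (inverse (\<Prod>i<k. qz (2 * i + 3))) \<le> prod_bound" "norm (inverse (\<Prod>i<Suc k. qz (2 * i + 1))) \<le> prod_bound"
    by (intro norm_prod_qz_ge; auto simp: inj_on_def)+
  have 4: "norm (\<Sum>i<Suc k. lambert (2 * i + 1)) \<le> 1 / (1 - norm q)^3"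
    "norm (\<Sum>i<k. lambert (i + 1)) \<le> 1 / (1 - norm q)^3"
    by (intro norm_sum_lambert_le; auto simp: inj_on_def)+
  let ?L = "(\<Sum>i<Suc k. lambert (2 * i + 1)) - (\<Sum>i<k. lambert (i + 1))"
  have 5: "norm ?L \<le> 2 / (1 - norm q)^3"
    using norm_triangle_ineq4[of "\<Sum>i<Suc k. lambert (2 * i + 1)" "\<Sum>i<k. lambert (i + 1)"] 4 by simp
  have eq: "dsummand n k = qz (3 * k + 2) * q ^ k * ((\<Prod>i<k. qz (2 * i + 2)) * inverse (\<Prod>i<k. qz (2 * i + 3)))
      * twist n k * ((\<Prod>i<k. qz (i + 1)) * inverse (\<Prod>i<Suc k. qz (2 * i + 1)))^2 * ?L"
    by (simp only: dsummand_def coef_def divide_inverse)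
  have "norm (dsummand n k) \<le> 2 * norm q ^ k * (prod_bound * prod_bound) * prod_bound ^ 4 * (prod_bound * prod_bound)^2 * (2 / (1 - norm q)^3)"
    unfolding eq norm_mult norm_power using prod_bound_ge_1 q
    by (intro mult_mono power_mono 1 2 3 5 norm_twist_le assms order_refl) auto
  also have "\<dots> = 4 * prod_bound ^ 10 / (1 - norm q)^3 * norm q ^ k"
    by (simp add: eval_nat_numeral mult_ac)
  finally show ?thesis .
qed

section \<open>The limit n to infinity\<close>

lemma tendsto_qz: "filterlim g at_top sequentially \<Longrightarrow> (\<lambda>n. qz (g n)) \<longlonglongrightarrow> 1"
  using tendsto_diff[OF tendsto_const filterlim_compose[OF LIMSEQ_power_zero[OF q]], of g sequentially 1]
  by (simp add: qz_def)

text \<open>This is the passage d to infinity: every \<open>qz\<close> factor has an exponent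
  growing with n and tends to 1, leaving q^(k choose 2).\<close>

lemma tendsto_twist: "(\<lambda>n. twist n k) \<longlonglongrightarrow> (\<Prod>i<k. q ^ i)"
proof -
  \<comment> \<open>The offset i allows for truncated subtraction in the exponents.\<close>
  have lin: "filterlim g at_top sequentially" if "\<And>n. n \<le> g n + i" for g :: "nat \<Rightarrow> nat" and i
  proof -
    have "\<exists>N. \<forall>n\<ge>N. Z \<le> g n" for Z
    proof (intro exI[of _ "Z + i"] allI impI)
      fix n assume "Z + i \<le> n"
      then show "Z \<le> g n" using that[of n] by simp
    qed
    then show ?thesis by (simp add: filterlim_at_top eventually_sequentially)
  qed
  have "(\<lambda>n. twist n k) \<longlonglongrightarrow> (\<Prod>i<k. q ^ i * (1 / 1) * (1 / 1))"
    unfolding twist_def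
  proof (intro tendsto_prod tendsto_mult tendsto_const tendsto_divide tendsto_qz)
    fix i
    show "filterlim (\<lambda>n. 2 * (n - i)) at_top sequentially" "filterlim (\<lambda>n. 2 * n - i) at_top sequentially"
      by (rule lin[of _ i]; simp)+
    show "filterlim (\<lambda>n. 2 * n + 3 + 2 * i) at_top sequentially" 
      "filterlim (\<lambda>n. 2 * n + 3 + i) at_top sequentially"
      by (rule lin[of _ 0]; simp)+
  qed auto
  then show ?thesis by simp
qed

definition dsummand_lim :: "nat \<Rightarrow> complex" where
  "dsummand_lim k = qz (3 * k + 2) * q ^ k * (qpoch (q^2) (q^2) k / qpoch (q^3) (q^2) k) * (\<Prod>i<k. q ^ i)
     * (qpoch q q k / qpoch q (q^2) (Suc k))^2
     * ((\<Sum>i<Suc k. lambert (2 * i + 1)) - (\<Sum>i<k. lambert (i + 1)))"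

lemma tendsto_qpoch: "(\<lambda>n. qpoch x (q^2) n) \<longlonglongrightarrow> qpoch_inf x (q^2)"
proof -
  have "norm (q^2) < 1" using q by (simp add: norm_power power_less_one_iff)
  from convergent_prod_LIMSEQ[OF convergent_prod_qpoch[OF this, of x]]
  have "(\<lambda>n. qpoch x (q^2) (Suc n)) \<longlonglongrightarrow> qpoch_inf x (q^2)"
    by (simp only: qpoch_def qpoch_inf_def lessThan_Suc_atMost)
  then show ?thesis by (rule filterlim_sequentially_Suc[THEN iffD1])
qed

lemma qpoch_inf_nonzero:
  assumes "m > 0"
  shows "qpoch_inf (q ^ m) (q^2) \<noteq> 0"
  unfolding qpoch_inf_def
proof (rule prodinf_nonzero)
  show "convergent_prod (\<lambda>i. 1 - q ^ m * (q\<^sup>2) ^ i)"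
    using q by (intro convergent_prod_qpoch) (simp add: norm_power power_less_one_iff)
  fix i
  show "1 - q ^ m * (q\<^sup>2) ^ i \<noteq> 0"
    using qz_nonzero[of "m + 2 * i"] assms by (simp add: qz_def power_add power_mult)
qed

text \<open>Odd indices m = j + 1 belong to even j, so the n + 1 odd and n even terms interleave
  into one alternating sum.\<close>

lemma alternating_lambert:
  "(\<Sum>i<Suc n. lambert (2 * i + 1)) - (\<Sum>i<n. lambert (2 * i + 2)) = (\<Sum>j<2 * n + 1. (-1) ^ j * lambert (j + 1))"
  by (induction n) (simp_all add: algebra_simps eval_nat_numeral power_add)

lemma tendsto_dtotal:
  "dtotal \<longlonglongrightarrow> qpoch_inf (q^2) (q^2) ^ 4 / (qpoch_inf q (q^2) ^ 3 * qpoch_inf (q^3) (q^2))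
     * (\<Sum>j. (-1) ^ j * lambert (j + 1))"
proof -
  let ?a = "qpoch_inf (q^2) (q^2)" and ?b = "qpoch_inf q (q^2)" and ?c = "qpoch_inf (q^3) (q^2)"
  have nz: "?b \<noteq> 0" "?c \<noteq> 0" using qpoch_inf_nonzero[of 1] qpoch_inf_nonzero[of 3] by simp_all
  \<comment> \<open>The sums of odd length 2n + 1 form a subsequence of the partial sums of a
    convergent series.\<close>
  have S: "(\<lambda>n. \<Sum>j<2 * n + 1. (-1) ^ j * lambert (j + 1)) \<longlonglongrightarrow> (\<Sum>j. (-1) ^ j * lambert (j + 1))"
    using LIMSEQ_subseq_LIMSEQ[OF summable_LIMSEQ[OF summable_lambert], of "\<lambda>n. 2 * n + 1"]
    by (simp add: strict_mono_def o_def)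
  have "dtotal \<longlonglongrightarrow> ?a * ?a / (?b * ?c) * (?a / ?b)^2 * (\<Sum>j. (-1) ^ j * lambert (j + 1))"
    unfolding dtotal_def total_coef_def alternating_lambert prod_qz_qpoch
    by (intro tendsto_intros tendsto_qpoch S LIMSEQ_Suc[OF tendsto_qpoch]) (use nz in auto)
  then show ?thesis by (simp add: eval_nat_numeral mult_ac)
qed

lemma dsummand_lim_sums:
  "summable dsummand_lim"
  "suminf dsummand_lim = qpoch_inf (q^2) (q^2) ^ 4 / (qpoch_inf q (q^2) ^ 3 * qpoch_inf (q^3) (q^2))
     * (\<Sum>j. (-1) ^ j * lambert (j + 1))"
proof -
  \<comment> \<open>Extending by 0 beyond k = n makes \<open>norm_dsummand_le\<close> give a bound
    for all k and n, and the series in k becomes the finite sum \<open>dtotal n\<close>.\<close>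
  define a where "a = (\<lambda>k n. if k \<le> n then dsummand n k else 0)"
  define M where "M = (\<lambda>k. 4 * prod_bound ^ 10 / (1 - norm q)^3 * norm q ^ k)"
  have lim: "a k \<longlonglongrightarrow> dsummand_lim k" for k
  proof -
    have "(\<lambda>n. dsummand n k) \<longlonglongrightarrow> dsummand_lim k"
      unfolding dsummand_def dsummand_lim_def coef_def prod_qz_qpoch by (intro tendsto_intros tendsto_twist)
    moreover have "\<forall>\<^sub>F n in sequentially. dsummand n k = a k n"
      using eventually_ge_at_top[of k] by eventually_elim (simp add: a_def)
    ultimately show ?thesis by (rule Lim_transform_eventually)
  qed
  have bound: "norm (a k n) \<le> M k" for k n
    using norm_dsummand_le[of k n] prod_bound_ge_1 q by (auto simp: a_def M_def)
  have "summable M" unfolding M_def using q by (intro summable_mult summable_geometric) auto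
  moreover have "\<forall>\<^sub>F (k, n) in at_top \<times>\<^sub>F sequentially. norm (a k n) \<le> M k"
    by (intro always_eventually) (use bound in auto)
  ultimately have T: "summable (\<lambda>n. norm (dsummand_lim n))" "(\<lambda>n. suminf (\<lambda>k. a k n)) \<longlonglongrightarrow> suminf dsummand_lim"
    using tannerys_theorem[of a dsummand_lim sequentially M] lim by auto
  show "summable dsummand_lim" using T(1) by (rule summable_norm_cancel)
  have "suminf (\<lambda>k. a k n) = dtotal n" for n
    using suminf_finite[of "{..n}" "\<lambda>k. a k n"] sum_dsummand[of n] by (simp add: a_def)
  with T(2) tendsto_dtotal show "suminf dsummand_lim = qpoch_inf (q^2) (q^2) ^ 4
      / (qpoch_inf q (q^2) ^ 3 * qpoch_inf (q^3) (q^2)) * (\<Sum>j. (-1) ^ j * lambert (j + 1))"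
    by (simp add: LIMSEQ_unique)
qed

section \<open>Return to q-integers and the final identity\<close>

lemma qint_eq: "qint q m = qz m / (1 - q)"
  using q by (auto simp: qint_def qz_def sum_gp_strict)

lemma lambert_qint: "q ^ m / (qint q m)^2 = (1 - q)^2 * lambert m"
  by (simp add: qint_eq lambert_def power_divide)

lemma power_choose_two: "q ^ ((k + 1) choose 2) = q ^ k * (\<Prod>i<k. q ^ i)"
  by (induction k) (simp_all add: numeral_2_eq_2 power_add mult_ac)

text \<open>The power of 1 - q collects -1 from \<open>qint q (3 * k + 2)\<close>, 2 from the sums
  in braces and 2 from the square of (q;q^2)_(k+1) = (1 - q) (q^3;q^2)_k. The sign comes from the
  reversed difference in \<open>dsummand_lim\<close>.\<close>

lemma series_term:
  "q ^ ((k + 1) choose 2) * qint q (3 * k + 2)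
     * ((qpoch q q k)^2 * qpoch (q^2) (q^2) k / (qpoch (q^3) (q^2) k)^3)
     * ((\<Sum>i=1..k. q ^ i / (qint q i)^2) - (\<Sum>i=1..k+1. q ^ (2 * i - 1) / (qint q (2 * i - 1))^2))
   = - ((1 - q)^3) * dsummand_lim k"
proof -
  have s1: "(\<Sum>i=1..k. q ^ i / (qint q i)^2) = (1 - q)^2 * (\<Sum>i<k. lambert (i + 1))"
    unfolding lambert_qint sum_distrib_left[symmetric]
    by (simp add: sum.atLeast1_atMost_eq)
  have s2: "(\<Sum>i=1..k+1. q ^ (2 * i - 1) / (qint q (2 * i - 1))^2) = (1 - q)^2 * (\<Sum>i<Suc k. lambert (2 * i + 1))"
    unfolding lambert_qint sum_distrib_left[symmetric]
    by (simp add: sum.atLeast1_atMost_eq)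
  have p: "qpoch q (q^2) (Suc k) = (1 - q) * qpoch (q^3) (q^2) k"
    unfolding qpoch_def prod.lessThan_Suc_shift by (simp add: eval_nat_numeral mult_ac)
  have "1 - q \<noteq> 0" using q by auto
  have alg: "Q * E * (x / u) * (B * A / C ^ 3) * (u\<^sup>2 * S1 - u\<^sup>2 * S2)
      = - (u ^ 3) * (x * Q * (A / C) * E * (b / (u * C))\<^sup>2 * (S2 - S1))"
    if "u \<noteq> 0" "B = b\<^sup>2" for Q E x u A B b C S1 S2 :: complex
    \<comment> \<open>For C = 0 both sides are 0, as x / 0 = 0.\<close>
    using that by (cases "C = 0") (simp_all add: field_simps eval_nat_numeral)
  show ?thesis
    unfolding s1 s2 unfolding power_choose_two qint_eq dsummand_lim_def p
    by (rule alg) (use \<open>1 - q \<noteq> 0\<close> in auto)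
qed

lemma alternating_term: "(-1) ^ (j + 1) * (q ^ (j + 1) / (qint q (j + 1))^2)
    = - ((1 - q)^2) * ((-1) ^ j * lambert (j + 1))"
  unfolding lambert_qint by simp

text \<open>Trades one of the three factors (q;q^2)_\<infinity> in the limit's denominator for a
  second (q^3;q^2)_\<infinity>. The resulting 1 - q reconciles (1 - q)^3 from
  \<open>series_term\<close> with (1 - q)^2 from \<open>alternating_term\<close>.\<close>

lemma qpoch_inf_shift: "qpoch_inf q (q^2) = (1 - q) * qpoch_inf (q^3) (q^2)"
proof -
  have "norm (q^2) < 1" using q by (simp add: norm_power power_less_one_iff)
  from qpoch_mult_qpoch_inf[OF this, of q 1] show ?thesis
    by (simp add: qpoch_def eval_nat_numeral)
qed

end

theorem theorem1p5:
  fixes q :: complex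
  assumes "norm q < 1"
  shows "summable (\<lambda>k. q ^ ((k + 1) choose 2) * qint q (3 * k + 2)
             * ((qpoch q q k)^2 * qpoch (q^2) (q^2) k / (qpoch (q^3) (q^2) k)^3)
             * ((\<Sum>i=1..k. q ^ i / (qint q i)^2)
                - (\<Sum>i=1..k+1. q ^ (2 * i - 1) / (qint q (2 * i - 1))^2)))
       \<and> summable (\<lambda>j. (- 1) ^ (j + 1) * (q ^ (j + 1) / (qint q (j + 1))^2))
       \<and> (\<Sum>k. q ^ ((k + 1) choose 2) * qint q (3 * k + 2)
             * ((qpoch q q k)^2 * qpoch (q^2) (q^2) k / (qpoch (q^3) (q^2) k)^3)
             * ((\<Sum>i=1..k. q ^ i / (qint q i)^2)
                - (\<Sum>i=1..k+1. q ^ (2 * i - 1) / (qint q (2 * i - 1))^2)))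
         = (qpoch_inf (q^2) (q^2))^4
              / ((qpoch_inf q (q^2))^2 * (qpoch_inf (q^3) (q^2))^2)
              * (\<Sum>j. (- 1) ^ (j + 1) * (q ^ (j + 1) / (qint q (j + 1))^2))"
proof -
  have "- (u ^ 3) * (A / ((u * C) ^ 3 * C) * L) = A / ((u * C)\<^sup>2 * C\<^sup>2) * (- (u\<^sup>2) * L)"
    if "u \<noteq> 0" for A C L u :: complex
    using that by (cases "C = 0") (simp_all add: field_simps eval_nat_numeral)
  moreover have "1 - q \<noteq> 0" using assms by auto
  ultimately have alg: "- ((1 - q) ^ 3) * (A / (((1 - q) * C) ^ 3 * C) * L)
      = A / (((1 - q) * C)\<^sup>2 * C\<^sup>2) * (- ((1 - q)\<^sup>2) * L)" for A C L
    by blast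
  show ?thesis
    unfolding series_term[OF assms] alternating_term[OF assms]
      suminf_mult[OF dsummand_lim_sums(1)[OF assms]] suminf_mult[OF summable_lambert[OF assms]]
      dsummand_lim_sums(2)[OF assms] qpoch_inf_shift[OF assms]
    by (intro conjI summable_mult dsummand_lim_sums(1) summable_lambert assms alg)
qed

end
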